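(* Let $f\in\mathbb M$ be a full branch piecewise monotone map of $[0,1]$ with $N$ branches, and let $\mu_{\mathrm{BM}}$ be the measure of maximal entropy of $f$ described in the context. For any $\nu>\frac1N$ there exists $C_\nu>0$ such that, for each $h\in W^{1,1}([0,1])$, each $\varphi\in L^1(\mu_{\mathrm{BM}})$ and each $n\in\mathbb N$, $$\left|\int h\,\varphi\circ f^n\,d\mu_{\mathrm{BM}}-\int h\,d\mu_{\mathrm{BM}}\int\varphi\circ f^n\,d\mu_{\mathrm{BM}}\right|\le C_\nu\,\nu^n\,\|h\|_{W^{1,1}}\,\|\varphi\|_{L^1(\mu_{\mathrm{BM}})}.$$
   Context: Let $\mathcal P=\{I_1,\dots,I_N\}$ be open disjoint intervals with $\bigcup_{i=1}^N\overline{I_i}=[0,1]$. $\mathbb M_*$ is the set of maps $f:[0,1]\to[0,1]$ such that each $f|_{I_i}$ is strictly monotone and $\mathcal C^1$, and $\|f'\|_\infty<\infty$. $\mathbb M=\{f\in\mathbb M_*: f(I_i)=(0,1)\text{ for all }i\}$. Let $\mathcal L_0h(x)=\sum_{y\in f^{-1}(x)}h(y)$ (sum over the $N$ inverse branches), acting on $W^{1,1}([0,1])$ (the paper's setting is that $\mathcal L_0W^{1,1}\subset W^{1,1}$). $\mu_{\mathrm{BM}}$ is the measure of maximal entropy of $f$ that appears in the spectral decomposition $\mathcal L_0h=N\mu_{\mathrm{BM}}(h)+Q(h)$ on $W^{1,1}$, where $Q1=0$, $\mu_{\mathrm{BM}}(Q(h))=0$ for all $h\in W^{1,1}$, and the spectrum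 of $Q$ on $W^{1,1}$ is contained in $\{|z|\le1\}$. *)

theory Defs
  imports "HOL-Probability.Probability"
begin

section \<open>Full branch piecewise monotone maps\<close>

definition interval_partition :: "nat \<Rightarrow> (nat \<Rightarrow> real set) \<Rightarrow> bool" where
  "interval_partition N I \<longleftrightarrow>
     (\<forall>i\<in>{1..N}. \<exists>a b. a < b \<and> I i = {a<..<b}) \<and>
     disjoint_family_on I {1..N} \<and>
     (\<Union>i\<in>{1..N}. closure (I i)) = {0..1}"

text \<open>The class \<open>M\<^sub>*\<close>. A map of \<open>[0,1]\<close> is a total function on the reals whose values
  outside \<open>[0,1]\<close> play no role. The values of the map at the endpoints of the intervals
  are not restricted.\<close>

definition pw_monotone_map :: "nat \<Rightarrow> (nat \<Rightarrow> real set) \<Rightarrow> (real \<Rightarrow> real) \<Rightarrow> bool" where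
  "pw_monotone_map N I f \<longleftrightarrow>
     interval_partition N I \<and>
     f ` {0..1} \<subseteq> {0..1} \<and>
     (\<forall>i\<in>{1..N}. (strict_mono_on (I i) f \<or> strict_antimono_on (I i) f) \<and>
                  f C1_differentiable_on I i) \<and>
     bounded (deriv f ` (\<Union>i\<in>{1..N}. I i))"

definition full_branch_map :: "nat \<Rightarrow> (nat \<Rightarrow> real set) \<Rightarrow> (real \<Rightarrow> real) \<Rightarrow> bool" where
  "full_branch_map N I f \<longleftrightarrow>
     pw_monotone_map N I f \<and> (\<forall>i\<in>{1..N}. f ` I i = {0<..<1})"


section \<open>The Sobolev space \<open>W\<^sup>1\<^sup>,\<^sup>1([0,1])\<close>\<close>

definition test_function :: "(real \<Rightarrow> real) \<Rightarrow> bool" where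
  "test_function \<psi> \<longleftrightarrow>
     \<psi> C1_differentiable_on UNIV \<and>
     (\<exists>K. compact K \<and> K \<subseteq> {0<..<1} \<and> (\<forall>x. x \<notin> K \<longrightarrow> \<psi> x = 0))"

definition is_weak_deriv :: "(real \<Rightarrow> complex) \<Rightarrow> (real \<Rightarrow> complex) \<Rightarrow> bool" where
  "is_weak_deriv h g \<longleftrightarrow>
     set_integrable lebesgue {0<..<1} g \<and>
     (\<forall>\<psi>. test_function \<psi> \<longrightarrow>
        (LINT x:{0<..<1}|lebesgue. h x * of_real (deriv \<psi> x)) =
        - (LINT x:{0<..<1}|lebesgue. g x * of_real (\<psi> x)))"

text \<open>Each class in \<open>W\<^sup>1\<^sup>,\<^sup>1\<close> has exactly one representative that is continuous on \<open>[0,1]\<close>;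
  the elements are given by this representative, so that they can be integrated against
  measures that are singular to Lebesgue measure. Two functions that agree on \<open>[0,1]\<close>
  stand for the same element. Scalars are complex, as is needed for spectra.\<close>

definition W11 :: "(real \<Rightarrow> complex) set" where
  "W11 = {h. continuous_on {0..1} h \<and> (\<exists>g. is_weak_deriv h g)}"

text \<open>Weak derivatives are unique up to null sets, so the choice does not affect the norm.\<close>

definition weak_deriv :: "(real \<Rightarrow> complex) \<Rightarrow> real \<Rightarrow> complex" where
  "weak_deriv h = (SOME g. is_weak_deriv h g)"

definition W11_norm :: "(real \<Rightarrow> complex) \<Rightarrow> real" where
  "W11_norm h = (LINT x:{0<..<1}|lebesgue. norm (h x)) +
                (LINT x:{0<..<1}|lebesgue. norm (weak_deriv h x))"

definition eq01 :: "(real \<Rightarrow> complex) \<Rightarrow> (real \<Rightarrow> complex) \<Rightarrow> bool" where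
  "eq01 h k \<longleftrightarrow> (\<forall>x\<in>{0..1}. h x = k x)"

definition W11_bounded_operator :: "((real \<Rightarrow> complex) \<Rightarrow> (real \<Rightarrow> complex)) \<Rightarrow> bool" where
  "W11_bounded_operator T \<longleftrightarrow>
     (\<forall>h\<in>W11. T h \<in> W11) \<and>
     (\<forall>h\<in>W11. \<forall>k\<in>W11. eq01 h k \<longrightarrow> eq01 (T h) (T k)) \<and>
     (\<forall>h\<in>W11. \<forall>k\<in>W11. eq01 (T (\<lambda>x. h x + k x)) (\<lambda>x. T h x + T k x)) \<and>
     (\<forall>c. \<forall>h\<in>W11. eq01 (T (\<lambda>x. c * h x)) (\<lambda>x. c * T h x)) \<and>
     (\<exists>C. \<forall>h\<in>W11. W11_norm (T h) \<le> C * W11_norm h)"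

definition W11_invertible :: "((real \<Rightarrow> complex) \<Rightarrow> (real \<Rightarrow> complex)) \<Rightarrow> bool" where
  "W11_invertible T \<longleftrightarrow>
     (\<exists>R. W11_bounded_operator R \<and> (\<forall>h\<in>W11. eq01 (R (T h)) h \<and> eq01 (T (R h)) h))"

definition W11_spectrum :: "((real \<Rightarrow> complex) \<Rightarrow> (real \<Rightarrow> complex)) \<Rightarrow> complex set" where
  "W11_spectrum T = {z. \<not> W11_invertible (\<lambda>h x. z * h x - T h x)}"


section \<open>The transfer operator\<close>

text \<open>The sum over the inverse branches of the maps \<open>f : I i \<rightarrow> (0,1)\<close>. It is meaningful on \<open>(0,1)\<close>
  only, which determines a continuous function on \<open>[0,1]\<close>.\<close>

definition transfer0 ::
    "nat \<Rightarrow> (nat \<Rightarrow> real set) \<Rightarrow> (real \<Rightarrow> real) \<Rightarrow> (real \<Rightarrow> complex) \<Rightarrow> real \<Rightarrow> complex" where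
  "transfer0 N I f h x = (\<Sum>i\<in>{1..N}. h (the_inv_into (I i) f x))"

definition transfer0_preserves_W11 :: "nat \<Rightarrow> (nat \<Rightarrow> real set) \<Rightarrow> (real \<Rightarrow> real) \<Rightarrow> bool" where
  "transfer0_preserves_W11 N I f \<longleftrightarrow>
     (\<forall>h\<in>W11. \<exists>k\<in>W11. \<forall>x\<in>{0<..<1}. transfer0 N I f h x = k x)"


section \<open>Measures of maximal entropy\<close>

definition invariant_prob :: "(real \<Rightarrow> real) \<Rightarrow> real measure \<Rightarrow> bool" where
  "invariant_prob f M \<longleftrightarrow>
     prob_space M \<and> sets M = sets (restrict_space borel {0..1}) \<and>
     f \<in> measurable M M \<and> distr M M f = M"

definition finite_meas_partition :: "'a measure \<Rightarrow> 'a set set \<Rightarrow> bool" where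
  "finite_meas_partition M \<xi> \<longleftrightarrow> finite \<xi> \<and> \<xi> \<subseteq> sets M \<and> partition_on (space M) \<xi>"

text \<open>The partition \<open>\<xi> \<or> f\<^sup>-\<^sup>1\<xi> \<or> \<dots> \<or> f\<^sup>-\<^sup>(\<^sup>n\<^sup>-\<^sup>1\<^sup>)\<xi>\<close>, possibly with the empty set as an
  additional member, which does not contribute to the entropy.\<close>

fun dyn_join :: "'a measure \<Rightarrow> ('a \<Rightarrow> 'a) \<Rightarrow> 'a set set \<Rightarrow> nat \<Rightarrow> 'a set set" where
  "dyn_join M f \<xi> 0 = {space M}"
| "dyn_join M f \<xi> (Suc n) =
     {A \<inter> ((f ^^ n) -` B \<inter> space M) | A B. A \<in> dyn_join M f \<xi> n \<and> B \<in> \<xi>}"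

definition partition_entropy :: "'a measure \<Rightarrow> 'a set set \<Rightarrow> real" where
  "partition_entropy M \<xi> = - (\<Sum>A\<in>\<xi>. measure M A * ln (measure M A))"

text \<open>The Kolmogorov--Sinai entropy. The limit exists for every invariant probability measure
  by subadditivity.\<close>

definition metric_entropy :: "'a measure \<Rightarrow> ('a \<Rightarrow> 'a) \<Rightarrow> ereal" where
  "metric_entropy M f =
     (SUP \<xi> \<in> {\<xi>. finite_meas_partition M \<xi>}.
        ereal (lim (\<lambda>n. partition_entropy M (dyn_join M f \<xi> n) / real n)))"

definition max_entropy_measure :: "(real \<Rightarrow> real) \<Rightarrow> real measure \<Rightarrow> bool" where
  "max_entropy_measure f M \<longleftrightarrow>
     invariant_prob f M \<and>
     (\<forall>M'. invariant_prob f M' \<longrightarrow> metric_entropy M' f \<le> metric_entropy M f)"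


section \<open>The measure \<open>\<mu>\<^sub>B\<^sub>M\<close>\<close>

definition spectral_decomposition ::
    "nat \<Rightarrow> (nat \<Rightarrow> real set) \<Rightarrow> (real \<Rightarrow> real) \<Rightarrow> real measure \<Rightarrow>
     ((real \<Rightarrow> complex) \<Rightarrow> (real \<Rightarrow> complex)) \<Rightarrow> bool" where
  "spectral_decomposition N I f M Q \<longleftrightarrow>
     W11_bounded_operator Q \<and>
     (\<forall>h\<in>W11. \<forall>x\<in>{0<..<1}.
        transfer0 N I f h x = of_nat N * (\<integral>y. h y \<partial>M) + Q h x) \<and>
     eq01 (Q (\<lambda>_. 1)) (\<lambda>_. 0) \<and>
     (\<forall>h\<in>W11. (\<integral>y. Q h y \<partial>M) = 0) \<and>
     W11_spectrum Q \<subseteq> {z. norm z \<le> 1}"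

definition is_mu_BM ::
    "nat \<Rightarrow> (nat \<Rightarrow> real set) \<Rightarrow> (real \<Rightarrow> real) \<Rightarrow> real measure \<Rightarrow> bool" where
  "is_mu_BM N I f M \<longleftrightarrow>
     max_entropy_measure f M \<and> (\<exists>Q. spectral_decomposition N I f M Q)"

end

theory Submission
  imports Defs
begin

text \<open>
  The decay rate comes from a pointwise estimate of iterated transfer operators. Write \<open>\<psi>\<^sub>1,
  \<dots>, \<psi>\<^sub>N\<close> for the inverse branches of \<open>f\<close>, extended continuously to
  \<open>[0,1]\<close>, and \<open>L h = \<Sum>\<^sub>i h \<circ> \<psi>\<^sub>i\<close>. Because
  \<open>f\<close> has full branches, the \<open>\<psi>\<^sub>i\<close> map \<open>[0,1]\<close> monotonically
  onto intervals with disjoint interiors, so the total variation of \<open>L h\<close> is at most that of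
  \<open>h\<close> (\<open>variation_at_most_sum_branches\<close>), although \<open>L 1 = N\<close>. Hence
  \<open>N\<^sup>-\<^sup>n L\<^sup>n h\<close> oscillates by at most \<open>N\<^sup>-\<^sup>n\<close> times
  the variation of \<open>h\<close>, which for \<open>h\<close> in \<open>W\<^sup>1\<^sup>,\<^sup>1\<close> is
  at most its norm (\<open>W11_variation_at_most\<close>).

  What turns this into a statement on correlations is the duality
  \<open>N \<integral> h (\<phi> \<circ> f) d\<mu> = \<integral> (L h) \<phi> d\<mu>\<close> (\<open>transfer_duality\<close>). Integrating the spectral decomposition
  gives \<open>N \<integral> h d\<mu> = \<Sum>\<^sub>i \<integral> h \<circ> \<psi>\<^sub>i d\<mu>\<close> for \<open>h\<close> in \<open>W\<^sup>1\<^sup>,\<^sup>1\<close>. The functions \<open>x \<mapsto> e\<^sup>i\<^sup>t\<^sup>x\<close> are of this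
  kind, so \<open>\<mu>\<close> and the average of its images under the \<open>\<psi>\<^sub>i\<close> have the same characteristic
  function and coincide (\<open>average_distr\<close>). The formula therefore holds for every integrable
  function, in particular for \<open>h (\<phi> \<circ> f)\<close>. It remains to replace \<open>f (\<psi>\<^sub>i x)\<close> by \<open>x\<close>, which is
  allowed for \<open>x\<close> in \<open>(0,1)\<close> only, because the values of \<open>f\<close> at the ends of its intervals of
  monotonicity are arbitrary. For \<open>N \<ge> 2\<close> the averaging formula shows that \<open>0\<close> and \<open>1\<close> carry no
  mass (\<open>AE_interior\<close>); for \<open>N = 1\<close> no decay is claimed and the trivial bound suffices.
\<close>

section \<open>Total variation and monotone inverse branches\<close>

text \<open>Induction that removes the rightmost interval: by disjointness the remaining ones lie to the
  left of its left end, which becomes the new right end.\<close>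

lemma sum_increments_disjoint_intervals:
  fixes F :: "real \<Rightarrow> real"
  assumes "finite S" and "\<And>i. i \<in> S \<Longrightarrow> a i < b i"
    and "disjoint_family_on (\<lambda>i. {a i<..<b i}) S"
    and "\<And>i. i \<in> S \<Longrightarrow> l \<le> a i \<and> b i \<le> r" and "l \<le> r" and "mono_on {l..r} F"
  shows "(\<Sum>i\<in>S. F (b i) - F (a i)) \<le> F r - F l"
  using assms
proof (induction S arbitrary: r rule: finite_ranking_induct[where f = a])
  case empty
  then show ?case by (auto simp: mono_on_def)
next
  case (insert x S)
  show ?case
  proof (cases "x \<in> S")
    case True
    then show ?thesis using insert by (simp add: insert_absorb)
  next
    case False
    have x: "a x < b x" "l \<le> a x" "b x \<le> r" using insert.prems by auto
    have le: "b i \<le> a x" if "i \<in> S" for i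
    proof (rule ccontr)
      assume "\<not> b i \<le> a x"
      then have "max (a i) (a x) < min (b i) (b x)"
        using insert.hyps(2)[OF that] insert.prems(1)[of i] x that by auto
      then obtain z where "max (a i) (a x) < z" "z < min (b i) (b x)" using dense by blast
      then have "z \<in> {a i<..<b i} \<inter> {a x<..<b x}" by auto
      moreover have "i \<noteq> x" using False that by auto
      ultimately show False
        using insert.prems(2) that unfolding disjoint_family_on_def by blast
    qed
    have "(\<Sum>i\<in>S. F (b i) - F (a i)) \<le> F (a x) - F l"
    proof (rule insert.IH)
      show "disjoint_family_on (\<lambda>i. {a i<..<b i}) S"
        using insert.prems(2) by (auto simp: disjoint_family_on_def)
      show "mono_on {l..a x} F" using insert.prems(5) x by (auto simp: mono_on_def)
    qed (use insert.prems x le in auto)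
    moreover have "F (b x) \<le> F r" using insert.prems(4,5) x by (auto simp: mono_on_def)
    ultimately show ?thesis using False insert.hyps by simp
  qed
qed

text \<open>The variation of \<open>h\<close> on \<open>[0,1]\<close> is at most \<open>V\<close>, expressed by a function \<open>F\<close> whose increments
  dominate those of \<open>h\<close>. Such an \<open>F\<close> is automatically nondecreasing. It is easier to compose with
  monotone maps and to sum than a supremum over subdivisions; for a Sobolev function it is the
  integral of the modulus of the weak derivative.\<close>

definition variation_at_most :: "(real \<Rightarrow> complex) \<Rightarrow> real \<Rightarrow> bool" where
  "variation_at_most h V \<longleftrightarrow>
     (\<exists>F. (\<forall>x y. 0 \<le> x \<and> x \<le> y \<and> y \<le> 1 \<longrightarrow> norm (h y - h x) \<le> F y - F x) \<and> F 1 - F 0 \<le> V)"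

lemma variation_at_most_norm_diff:
  assumes "variation_at_most h V" and "x \<in> {0..1}" and "y \<in> {0..1}"
  shows "norm (h y - h x) \<le> V"
proof -
  obtain F where F: "\<And>x y. 0 \<le> x \<Longrightarrow> x \<le> y \<Longrightarrow> y \<le> 1 \<Longrightarrow> norm (h y - h x) \<le> F y - F x"
    and V: "F 1 - F 0 \<le> V"
    using assms(1) unfolding variation_at_most_def by blast
  have mono: "F x \<le> F y" if "0 \<le> x" "x \<le> y" "y \<le> 1" for x y
    using order_trans[OF norm_ge_zero F[OF that]] by simp
  have "norm (h y - h x) \<le> V" if "0 \<le> x" "x \<le> y" "y \<le> 1" for x y
    using F[OF that] V mono[of 0 x] mono[of y 1] that by simp
  from this[of x y] this[of y x] show ?thesis
    using assms(2,3) by (cases "x \<le> y") (auto simp: norm_minus_commute)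
qed

text \<open>A monotone homeomorphism from \<open>[0,1]\<close> onto \<open>[a,b]\<close>. Continuity and monotonicity are demanded on
  the whole line, where they need no side conditions.\<close>

definition is_branch :: "real \<Rightarrow> real \<Rightarrow> (real \<Rightarrow> real) \<Rightarrow> bool" where
  "is_branch a b \<psi> \<longleftrightarrow> continuous_on UNIV \<psi> \<and>
     (strict_mono_on UNIV \<psi> \<and> \<psi> 0 = a \<and> \<psi> 1 = b \<or>
      strict_antimono_on UNIV \<psi> \<and> \<psi> 0 = b \<and> \<psi> 1 = a)"

lemma is_branch_range:
  assumes "is_branch a b \<psi>" and "x \<in> {0..1}"
  shows "\<psi> x \<in> {a..b}"
  using assms unfolding is_branch_def monotone_on_def
  by (cases "x = 0"; cases "x = 1") (auto intro: less_imp_le)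

lemma is_branch_interior:
  assumes "is_branch a b \<psi>" and "x \<in> {0<..<1}"
  shows "\<psi> x \<in> {a<..<b}"
  using assms unfolding is_branch_def monotone_on_def by auto

lemma is_branch_inj:
  assumes "is_branch a b \<psi>"
  shows "inj \<psi>"
  using assms unfolding is_branch_def
  by (metis linorder_injI monotone_on_def UNIV_I less_irrefl)

text \<open>The key estimate: the bound does not grow with the number of branches. Each \<open>\<psi> i\<close> contributes
  the variation of \<open>h\<close> over its own range, and these ranges do not overlap. The new dominating
  function is the sum of the functions \<open>F \<circ> \<psi> i\<close>, with a minus sign for decreasing branches.\<close>

lemma variation_at_most_sum_branches:
  assumes h: "variation_at_most h V" and "finite S"
    and br: "\<And>i. i \<in> S \<Longrightarrow> is_branch (a i) (b i) (\<psi> i)"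
    and ab: "\<And>i. i \<in> S \<Longrightarrow> 0 \<le> a i \<and> a i < b i \<and> b i \<le> 1"
    and disj: "disjoint_family_on (\<lambda>i. {a i<..<b i}) S"
  shows "variation_at_most (\<lambda>x. \<Sum>i\<in>S. h (\<psi> i x)) V"
proof -
  obtain F where F: "\<And>x y. 0 \<le> x \<Longrightarrow> x \<le> y \<Longrightarrow> y \<le> 1 \<Longrightarrow> norm (h y - h x) \<le> F y - F x"
    and V: "F 1 - F 0 \<le> V"
    using h unfolding variation_at_most_def by blast
  define s where "s i = (if strict_mono_on UNIV (\<psi> i) then 1 else (-1::real))" for i
  have *: "norm (h (\<psi> i y) - h (\<psi> i x)) \<le> s i * F (\<psi> i y) - s i * F (\<psi> i x)"
    if "0 \<le> x" "x \<le> y" "y \<le> 1" "i \<in> S" for i x y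
  proof -
    have in01: "0 \<le> \<psi> i x" "\<psi> i x \<le> 1" "0 \<le> \<psi> i y" "\<psi> i y \<le> 1"
      using is_branch_range[OF br, of i x] is_branch_range[OF br, of i y] ab[of i] that by auto
    show ?thesis
    proof (cases "strict_mono_on UNIV (\<psi> i)")
      case True
      then have "\<psi> i x \<le> \<psi> i y" using that by (simp add: strict_mono_less_eq)
      then show ?thesis using F[of "\<psi> i x" "\<psi> i y"] in01 True by (simp add: s_def)
    next
      case False
      then have "strict_antimono_on UNIV (\<psi> i)" using br[OF that(4)] by (auto simp: is_branch_def)
      then have "\<psi> i y \<le> \<psi> i x"
        using that unfolding monotone_on_def by (metis UNIV_I order_le_less)
      then show ?thesis using F[of "\<psi> i y" "\<psi> i x"] in01 False
        by (simp add: s_def norm_minus_commute)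
    qed
  qed
  have ends: "s i * F (\<psi> i 1) - s i * F (\<psi> i 0) = F (b i) - F (a i)" if "i \<in> S" for i
  proof -
    have "\<not> strict_antimono_on UNIV (\<psi> i)" if "strict_mono_on UNIV (\<psi> i)"
      using that unfolding monotone_on_def by (metis UNIV_I less_asym zero_less_one)
    then show ?thesis using br[OF that] by (auto simp: s_def is_branch_def)
  qed
  have "mono_on {0..1} F"
    using order_trans[OF norm_ge_zero F] by (auto simp: mono_on_def)
  then have "(\<Sum>i\<in>S. F (b i) - F (a i)) \<le> F 1 - F 0"
    using \<open>finite S\<close> ab disj by (intro sum_increments_disjoint_intervals) auto
  then show ?thesis
    unfolding variation_at_most_def
    using * ends V
    by (intro exI[of _ "\<lambda>x. \<Sum>i\<in>S. s i * F (\<psi> i x)"])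
       (auto simp: sum_subtractf[symmetric] intro!: sum_norm_le)
qed

text \<open>The inverse is extended by translations on both sides of \<open>[0,1]\<close>. The extension is strictly
  increasing and onto, and a monotone function with open range is continuous.\<close>

lemma increasing_inverse_branch:
  fixes f :: "real \<Rightarrow> real"
  assumes ab: "a < b" and mono: "strict_mono_on {a<..<b} f" and im: "f ` {a<..<b} = {0<..<1}"
  obtains \<psi> where "continuous_on UNIV \<psi>" "strict_mono_on UNIV \<psi>" "\<psi> 0 = a" "\<psi> 1 = b"
    "\<And>x. x \<in> {0<..<1} \<Longrightarrow> \<psi> x \<in> {a<..<b} \<and> f (\<psi> x) = x"
proof -
  define g where "g = the_inv_into {a<..<b} f"
  have inj: "inj_on f {a<..<b}" using mono by (rule strict_mono_on_imp_inj_on)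
  have g: "g x \<in> {a<..<b} \<and> f (g x) = x" if "x \<in> {0<..<1}" for x
    using that im f_the_inv_into_f[OF inj] the_inv_into_into[OF inj, of x "{a<..<b}"]
    unfolding g_def by auto
  have gmono: "g x < g y" if "x \<in> {0<..<1}" "y \<in> {0<..<1}" "x < y" for x y
    using g[OF that(1)] g[OF that(2)] that mono
    by (metis linorder_less_linear order_less_asym monotone_onD)
  define \<psi> where "\<psi> x = (if x \<le> 0 then a + x else if 1 \<le> x then b + (x - 1) else g x)" for x
  have "strict_mono_on UNIV \<psi>"
  proof (rule monotone_onI)
    fix x y :: real assume "x < y"
    then show "\<psi> x < \<psi> y"
      using gmono[of x y] g[of x] g[of y] ab by (auto simp: \<psi>_def)
  qed
  moreover have "y \<in> range \<psi>" for y
  proof (cases "a < y \<and> y < b")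
    case True
    then have "f y \<in> {0<..<1}" "g (f y) = y"
      using im the_inv_into_f_f[OF inj] by (auto simp: g_def)
    then have "\<psi> (f y) = y" by (auto simp: \<psi>_def)
    then show ?thesis by (metis rangeI)
  next
    case False
    then have "\<psi> (y - a) = y \<or> \<psi> (y - b + 1) = y" using ab by (auto simp: \<psi>_def)
    then show ?thesis by (metis rangeI)
  qed
  then have "range \<psi> = UNIV" by auto
  then have "continuous_on UNIV \<psi>"
    using \<open>strict_mono_on UNIV \<psi>\<close> by (intro continuous_onI_mono) (auto simp: strict_mono_less_eq)
  ultimately show thesis
    using g by (intro that[of \<psi>]) (auto simp: \<psi>_def)
qed

lemma inverse_branch_exists:
  fixes f :: "real \<Rightarrow> real"
  assumes ab: "a < b" and mono: "strict_mono_on {a<..<b} f \<or> strict_antimono_on {a<..<b} f"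
    and im: "f ` {a<..<b} = {0<..<1}"
  shows "\<exists>\<psi>. is_branch a b \<psi> \<and> (\<forall>x\<in>{0<..<1}. \<psi> x \<in> {a<..<b} \<and> f (\<psi> x) = x \<and>
            the_inv_into {a<..<b} f x = \<psi> x)"
proof -
  have inj: "inj_on f {a<..<b}" using mono
    by (auto intro!: linorder_inj_onI' dest: monotone_onD)
  have "\<exists>\<psi>. is_branch a b \<psi> \<and> (\<forall>x\<in>{0<..<1}. \<psi> x \<in> {a<..<b} \<and> f (\<psi> x) = x)"
    using mono
  proof
    assume "strict_mono_on {a<..<b} f"
    from increasing_inverse_branch[OF ab this im] show ?thesis
      unfolding is_branch_def by (metis (no_types, lifting))
  next
    assume "strict_antimono_on {a<..<b} f"
    \<comment> \<open>Reflecting the values reduces a decreasing branch to an increasing one.\<close>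
    then have "strict_mono_on {a<..<b} (\<lambda>x. 1 - f x)" by (auto simp: monotone_on_def)
    moreover have "(\<lambda>x. 1 - f x) ` {a<..<b} = {0<..<1}"
    proof -
      have "(\<lambda>x. 1 - f x) ` {a<..<b} = (\<lambda>x. 1 - x) ` f ` {a<..<b}" by (simp add: image_image)
      also have "\<dots> = {0<..<1}"
        unfolding im
      proof (intro equalityI subsetI)
        fix x :: real assume "x \<in> {0<..<1}"
        then show "x \<in> (-) 1 ` {0<..<1}" by (intro image_eqI[of _ _ "1 - x"]) auto
      qed auto
      finally show ?thesis .
    qed
    ultimately obtain \<psi> where \<psi>: "continuous_on UNIV \<psi>" "strict_mono_on UNIV \<psi>" "\<psi> 0 = a" "\<psi> 1 = b"
      "\<And>x. x \<in> {0<..<1} \<Longrightarrow> \<psi> x \<in> {a<..<b} \<and> 1 - f (\<psi> x) = x"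
      by (rule increasing_inverse_branch[OF ab]) blast
    have "is_branch a b (\<lambda>x. \<psi> (1 - x))"
      unfolding is_branch_def using \<psi>(1-4)
      by (auto simp: monotone_on_def intro!: continuous_on_compose2[OF \<psi>(1)] continuous_intros)
    moreover have "\<psi> (1 - x) \<in> {a<..<b} \<and> f (\<psi> (1 - x)) = x" if "x \<in> {0<..<1}" for x
      using \<psi>(5)[of "1 - x"] that by auto
    ultimately show ?thesis by blast
  qed
  then obtain \<psi> where "is_branch a b \<psi>"
    and \<psi>: "\<And>x. x \<in> {0<..<1} \<Longrightarrow> \<psi> x \<in> {a<..<b} \<and> f (\<psi> x) = x"
    by blast
  moreover have "the_inv_into {a<..<b} f x = \<psi> x" if "x \<in> {0<..<1}" for x
    using \<psi>[OF that] by (intro the_inv_into_f_eq[OF inj]) auto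
  ultimately show ?thesis by blast
qed

section \<open>Sobolev functions\<close>

lemma integrable_on_unit_interval:
  fixes h :: "real \<Rightarrow> 'b::euclidean_space"
  assumes "continuous_on {0..1} h"
  shows "set_integrable lebesgue {0<..<1} h"
  using absolutely_integrable_continuous_real[OF assms]
  by (rule set_integrable_subset) auto

lemma integral_derivative_unit_interval:
  fixes F :: "real \<Rightarrow> 'b::euclidean_space"
  assumes "\<And>x. (F has_vector_derivative F' x) (at x)" and "continuous_on {0..1} F'"
  shows "(LINT x:{0<..<1}|lebesgue. F' x) = F 1 - F 0"
proof -
  have "(F' has_integral F 1 - F 0) {0..1}"
    using assms(1) by (intro fundamental_theorem_of_calculus) (auto intro: has_vector_derivative_at_within)
  then have "integral {0<..<1} F' = F 1 - F 0"
    by (metis integral_open_interval_real integral_unique)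
  then show ?thesis
    using set_lebesgue_integral_eq_integral(2)[OF integrable_on_unit_interval[OF assms(2)]] by simp
qed

text \<open>Integration by parts: the derivative of \<open>h \<cdot> \<psi>\<close> integrates to zero, since a test function
  vanishes at \<open>0\<close> and \<open>1\<close>.\<close>

lemma C1_in_W11:
  assumes h: "\<And>x. (h has_vector_derivative h' x) (at x)" and h': "continuous_on UNIV h'"
  shows "h \<in> W11"
proof -
  have conth: "continuous_on UNIV h"
    using h by (meson continuous_at_imp_continuous_on has_vector_derivative_continuous)
  have "is_weak_deriv h h'"
    unfolding is_weak_deriv_def
  proof (intro conjI allI impI)
    show "set_integrable lebesgue {0<..<1} h'"
      by (intro integrable_on_unit_interval continuous_on_subset[OF h']) simp
    fix \<psi> assume "test_function \<psi>"
    then obtain D K where D: "\<And>x. (\<psi> has_vector_derivative D x) (at x)" and contD: "continuous_on UNIV D"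
      and K: "K \<subseteq> {0<..<1}" "\<And>x. x \<notin> K \<Longrightarrow> \<psi> x = 0"
      unfolding test_function_def C1_differentiable_on_def by auto
    have ends: "\<psi> 0 = 0" "\<psi> 1 = 0" using K(1) by (auto intro!: K(2))
    have D\<psi>: "(\<psi> has_real_derivative D x) (at x)" for x
      using D[of x] by (simp add: has_real_derivative_iff_has_vector_derivative)
    have "deriv \<psi> = D" by (intro ext DERIV_imp_deriv D\<psi>)
    have cont\<psi>: "continuous_on UNIV \<psi>"
      using D by (meson continuous_at_imp_continuous_on has_vector_derivative_continuous)
    have int: "set_integrable lebesgue {0<..<1} (\<lambda>x. h x * of_real (D x))"
      "set_integrable lebesgue {0<..<1} (\<lambda>x. h' x * of_real (\<psi> x))"
      by (intro integrable_on_unit_interval continuous_on_mult continuous_on_of_real;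
          rule continuous_on_subset[OF _ subset_UNIV]; fact)+
    have "(LINT x:{0<..<1}|lebesgue. h x * of_real (D x) + h' x * of_real (\<psi> x))
            = h 1 * of_real (\<psi> 1) - h 0 * of_real (\<psi> 0)"
    proof (rule integral_derivative_unit_interval)
      show "((\<lambda>x. h x * of_real (\<psi> x)) has_vector_derivative h x * of_real (D x) + h' x * of_real (\<psi> x)) (at x)" for x
        by (intro has_vector_derivative_mult h has_vector_derivative_of_real D\<psi>)
      show "continuous_on {0..1} (\<lambda>x. h x * of_real (D x) + h' x * of_real (\<psi> x))"
        by (intro continuous_on_add continuous_on_mult continuous_on_of_real;
            rule continuous_on_subset[OF _ subset_UNIV]; fact)
    qed
    then show "(LINT x:{0<..<1}|lebesgue. h x * of_real (deriv \<psi> x)) =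
        - (LINT x:{0<..<1}|lebesgue. h' x * of_real (\<psi> x))"
      using int by (simp add: set_integral_add ends \<open>deriv \<psi> = D\<close> eq_neg_iff_add_eq_0)
  qed
  then show ?thesis
    unfolding W11_def using conth by (auto intro: continuous_on_subset)
qed

lemma iexp_in_W11: "(\<lambda>x. iexp (t * x)) \<in> W11"
proof (rule C1_in_W11)
  show "((\<lambda>x. iexp (t * x)) has_vector_derivative t *\<^sub>R (\<i> * iexp (t * x))) (at x)" for x
  proof -
    have "((\<lambda>x. t * x) has_vector_derivative t) (at x)"
      unfolding has_real_derivative_iff_has_vector_derivative[symmetric]
      by (auto intro!: derivative_eq_intros)
    from vector_diff_chain_at[OF this has_vector_derivative_iexp] show ?thesis
      by (simp add: o_def)
  qed
  show "continuous_on UNIV (\<lambda>x. t *\<^sub>R (\<i> * iexp (t * x)))"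
    by (intro continuous_intros)
qed

text \<open>The next functions build \<open>C\<^sup>1\<close> test functions. The second difference of a truncated parabola
  rises from \<open>0\<close> to \<open>1\<close> on \<open>[0,2]\<close>, and its derivative is a piecewise linear hat.\<close>

definition half_square :: "real \<Rightarrow> real" where
  "half_square t = (max 0 t)\<^sup>2 / 2"

lemma half_square_deriv: "(half_square has_real_derivative max 0 t) (at t)"
proof -
  consider "t < 0" | "t = 0" | "t > 0" by linarith
  then show ?thesis
  proof cases
    case 1
    have "(half_square has_real_derivative 0) (at t) \<longleftrightarrow> ((\<lambda>_. 0) has_real_derivative 0) (at t)"
      using eventually_nhds_in_open[of "{..<0}" t] 1
      by (intro DERIV_cong_ev) (auto elim!: eventually_mono simp: half_square_def)
    then show ?thesis using 1 by simp
  next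
    case 2
    have "((\<lambda>h. half_square h / h) \<longlongrightarrow> 0) (at 0)"
    proof (rule Lim_null_comparison)
      show "\<forall>\<^sub>F h in at 0. norm (half_square h / h) \<le> \<bar>h\<bar>"
        by (intro always_eventually)
           (auto simp: half_square_def max_def power2_eq_square abs_mult divide_simps)
      show "((\<lambda>h::real. \<bar>h\<bar>) \<longlongrightarrow> 0) (at 0)" by (auto intro!: tendsto_eq_intros)
    qed
    then show ?thesis using 2 by (simp add: DERIV_def half_square_def)
  next
    case 3
    have "(half_square has_real_derivative t) (at t) \<longleftrightarrow> ((\<lambda>t. t\<^sup>2 / 2) has_real_derivative t) (at t)"
      using eventually_nhds_in_open[of "{0<..}" t] 3
      by (intro DERIV_cong_ev) (auto elim!: eventually_mono simp: half_square_def)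
    moreover have "((\<lambda>t. t\<^sup>2 / 2) has_real_derivative t) (at t)"
      by (auto intro!: derivative_eq_intros)
    ultimately show ?thesis using 3 by simp
  qed
qed

definition tent :: "real \<Rightarrow> real" where
  "tent t = max 0 t - 2 * max 0 (t - 1) + max 0 (t - 2)"

definition smooth_step :: "real \<Rightarrow> real" where
  "smooth_step t = half_square t - 2 * half_square (t - 1) + half_square (t - 2)"

lemma smooth_step_deriv: "(smooth_step has_real_derivative tent t) (at t)"
  unfolding smooth_step_def tent_def
  by (auto intro!: derivative_eq_intros DERIV_chain2[OF half_square_deriv])

lemma smooth_step_scaled_deriv:
  assumes "\<eta> > 0"
  shows "((\<lambda>t. smooth_step ((t - u) / \<eta>)) has_real_derivative tent ((t - u) / \<eta>) / \<eta>) (at t)"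
proof -
  have "((\<lambda>t. (t - u) / \<eta>) has_real_derivative 1 / \<eta>) (at t)"
    using assms by (auto intro!: derivative_eq_intros)
  from DERIV_chain2[OF smooth_step_deriv this] show ?thesis by simp
qed

lemma smooth_step_const: "t \<le> 0 \<Longrightarrow> smooth_step t = 0" "2 \<le> t \<Longrightarrow> smooth_step t = 1"
  unfolding smooth_step_def half_square_def
  by (auto simp: max_def field_simps power2_eq_square)

lemma tent_nonneg: "0 \<le> tent t" and tent_zero: "t \<notin> {0..2} \<Longrightarrow> tent t = 0"
  unfolding tent_def by (auto simp: max_def)

lemma continuous_on_tent: "continuous_on A tent"
  unfolding tent_def by (intro continuous_intros)

lemma smooth_step_bounds: "0 \<le> smooth_step t" "smooth_step t \<le> 1"
proof -
  have mono: "smooth_step x \<le> smooth_step y" if "x \<le> y" for x y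
    using that smooth_step_deriv tent_nonneg by (blast intro: DERIV_nonneg_imp_nondecreasing)
  show "0 \<le> smooth_step t"
    using mono[of t 0] mono[of 0 t] smooth_step_const(1)[of t] smooth_step_const(1)[of 0] by linarith
  show "smooth_step t \<le> 1"
    using mono[of 2 t] mono[of t 2] smooth_step_const(2)[of t] smooth_step_const(2)[of 2] by linarith
qed

text \<open>The rescaled hat is a probability density on the interval from \<open>u\<close> to \<open>u + 2\<eta>\<close>.\<close>

lemma bump_average:
  fixes h :: "real \<Rightarrow> complex"
  assumes h: "continuous_on {0..1} h" and "\<eta> > 0" and u: "0 \<le> u" "u + 2 * \<eta> \<le> 1"
    and close: "\<And>t. t \<in> {u..u + 2 * \<eta>} \<Longrightarrow> norm (h t - c) \<le> \<delta>"
  shows "norm ((LINT t:{0<..<1}|lebesgue. h t * of_real (tent ((t - u) / \<eta>) / \<eta>)) - c) \<le> \<delta>"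
proof -
  define \<rho> where "\<rho> t = tent ((t - u) / \<eta>) / \<eta>" for t
  have cont: "continuous_on {0..1} \<rho>"
    unfolding \<rho>_def by (intro continuous_intros continuous_on_compose2[OF continuous_on_tent[of UNIV]]) (use \<open>\<eta> > 0\<close> in auto)
  have nonneg: "0 \<le> \<rho> t" for t unfolding \<rho>_def using tent_nonneg \<open>\<eta> > 0\<close> by simp
  have "((\<lambda>t. smooth_step ((t - u) / \<eta>)) has_vector_derivative \<rho> t) (at t)" for t
    unfolding \<rho>_def has_real_derivative_iff_has_vector_derivative[symmetric]
    by (intro smooth_step_scaled_deriv \<open>\<eta> > 0\<close>)
  then have "(LINT t:{0<..<1}|lebesgue. \<rho> t) = smooth_step ((1 - u) / \<eta>) - smooth_step ((0 - u) / \<eta>)"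
    using cont by (rule integral_derivative_unit_interval)
  also have "\<dots> = 1"
    using \<open>\<eta> > 0\<close> u smooth_step_const by (simp add: field_simps)
  finally have mass: "(LINT t:{0<..<1}|lebesgue. \<rho> t) = 1" .
  have int\<rho>: "set_integrable lebesgue {0<..<1} \<rho>" using integrable_on_unit_interval[OF cont] .
  have int: "set_integrable lebesgue {0<..<1} (\<lambda>t. h t * of_real (\<rho> t))"
    "set_integrable lebesgue {0<..<1} (\<lambda>t. c * of_real (\<rho> t))"
    by (intro integrable_on_unit_interval continuous_intros h cont)+
  have "c = (LINT t:{0<..<1}|lebesgue. c * of_real (\<rho> t))"
    using mass by (simp add: set_integral_complex_of_real)
  then have "(LINT t:{0<..<1}|lebesgue. h t * of_real (\<rho> t)) - c
     = (LINT t:{0<..<1}|lebesgue. h t * of_real (\<rho> t) - c * of_real (\<rho> t))"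
    using set_integral_diff(2)[OF int] by simp
  also have "norm \<dots> \<le> (LINT t:{0<..<1}|lebesgue. \<delta> * \<rho> t)"
    unfolding set_lebesgue_integral_def
  proof (rule Bochner_Integration.integral_norm_bound_integral)
    show "integrable lebesgue (\<lambda>t. indicator {0<..<1} t *\<^sub>R (h t * of_real (\<rho> t) - c * of_real (\<rho> t)))"
      using set_integral_diff(1)[OF int] by (simp add: set_integrable_def)
    show "integrable lebesgue (\<lambda>t. indicator {0<..<1} t *\<^sub>R (\<delta> * \<rho> t))"
      using int\<rho> by (simp add: set_integrable_def flip: mult.left_commute)
    fix t
    have "norm (h t - c) * \<rho> t \<le> \<delta> * \<rho> t"
    proof (cases "t \<in> {u..u + 2 * \<eta>}")
      case True
      then show ?thesis using close nonneg by (intro mult_right_mono) auto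
    next
      case False
      then have "\<rho> t = 0" unfolding \<rho>_def using \<open>\<eta> > 0\<close> by (subst tent_zero) (auto simp: field_simps)
      then show ?thesis by simp
    qed
    then show "norm (indicator {0<..<1} t *\<^sub>R (h t * of_real (\<rho> t) - c * of_real (\<rho> t)))
         \<le> indicator {0<..<1} t *\<^sub>R (\<delta> * \<rho> t)"
      using nonneg[of t] by (auto simp: indicator_def norm_mult simp flip: left_diff_distrib)
  qed
  also have "\<dots> = \<delta>" using mass by simp
  finally show ?thesis unfolding \<rho>_def .
qed

text \<open>The test function \<open>\<psi>\<close> is a trapezoid that rises just to the right of \<open>x\<close> and falls just to the
  left of \<open>y\<close>. Integrating \<open>h\<close> against its derivative gives the difference of two local averages
  of \<open>h\<close>, which are close to \<open>h x\<close> and \<open>h y\<close> by uniform continuity. The weak derivative is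
  integrated against \<open>\<psi>\<close> itself, which has modulus at most \<open>1\<close> and lives in the interval from \<open>x\<close> to \<open>y\<close>.\<close>

lemma weak_deriv_increment_bound:
  assumes h: "continuous_on {0..1} h" and g: "is_weak_deriv h g"
    and xy: "0 \<le> x" "x \<le> y" "y \<le> 1"
  shows "norm (h y - h x) \<le> (LINT t:{x<..<y}|lebesgue. norm (g t))"
proof (cases "x = y")
  case False
  with xy have "x < y" by simp
  have intg: "set_integrable lebesgue {0<..<1} g" using g by (simp add: is_weak_deriv_def)
  then have intng: "set_integrable lebesgue {x<..<y} (\<lambda>t. norm (g t))"
    using xy by (intro set_integrable_subset[OF set_integrable_norm[OF intg]]) auto
  show ?thesis
  proof (rule field_le_epsilon)
    fix e :: real assume "e > 0"
    obtain d where "d > 0" and d: "\<And>s t. s \<in> {0..1} \<Longrightarrow> t \<in> {0..1} \<Longrightarrow> \<bar>s - t\<bar> < d \<Longrightarrow> norm (h s - h t) \<le> e / 2"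
    proof -
      have "uniformly_continuous_on {0..1} h"
        using h by (simp add: compact_uniformly_continuous)
      then show thesis
        using \<open>e > 0\<close> unfolding uniformly_continuous_on_def
        by (metis that half_gt_zero less_imp_le dist_norm dist_commute real_norm_def)
    qed
    \<comment> \<open>With a sixth of the length, the margins and the ramps at both ends do not overlap.\<close>
    define \<eta> where "\<eta> = min ((y - x) / 6) (d / 6)"
    have \<eta>: "\<eta> > 0" "6 * \<eta> \<le> y - x" "6 * \<eta> \<le> d"
      using \<open>x < y\<close> \<open>d > 0\<close> by (auto simp: \<eta>_def min_def)
    define u v where "u = x + \<eta>" and "v = y - 3 * \<eta>"
    define r where "r w t = tent ((t - w) / \<eta>) / \<eta>" for w t
    define \<psi> where "\<psi> t = smooth_step ((t - u) / \<eta>) - smooth_step ((t - v) / \<eta>)" for t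
    have D\<psi>: "(\<psi> has_real_derivative r u t - r v t) (at t)" for t
      unfolding \<psi>_def r_def by (intro DERIV_diff smooth_step_scaled_deriv \<open>\<eta> > 0\<close>)
    have cont: "continuous_on A (r w)" for A w
      unfolding r_def by (intro continuous_intros continuous_on_compose2[OF continuous_on_tent[of UNIV]]) (use \<eta> in auto)
    have supp: "\<psi> t = 0" if "t \<notin> {x + \<eta>..y - \<eta>}" for t
    proof (cases "t < x + \<eta>")
      case True
      then have "(t - u) / \<eta> \<le> 0" "(t - v) / \<eta> \<le> 0" using \<eta> by (auto simp: u_def v_def divide_simps)
      then show ?thesis by (simp add: \<psi>_def smooth_step_const)
    next
      case False
      then have "2 \<le> (t - u) / \<eta>" "2 \<le> (t - v) / \<eta>" using \<eta> that by (auto simp: u_def v_def divide_simps)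
      then show ?thesis by (simp add: \<psi>_def smooth_step_const)
    qed
    have \<psi>1: "\<bar>\<psi> t\<bar> \<le> 1" for t
      using smooth_step_bounds[of "(t - u) / \<eta>"] smooth_step_bounds[of "(t - v) / \<eta>"] by (simp add: \<psi>_def)
    have "test_function \<psi>"
      unfolding test_function_def C1_differentiable_on_def
    proof (intro conjI exI)
      show "\<forall>t\<in>UNIV. (\<psi> has_vector_derivative r u t - r v t) (at t)"
        using D\<psi> by (simp add: has_real_derivative_iff_has_vector_derivative)
      show "continuous_on UNIV (\<lambda>t. r u t - r v t)" by (intro continuous_intros cont)
      show "compact {x + \<eta>..y - \<eta>}" by simp
      show "{x + \<eta>..y - \<eta>} \<subseteq> {0<..<1}" using \<eta> xy by auto
      show "\<forall>t. t \<notin> {x + \<eta>..y - \<eta>} \<longrightarrow> \<psi> t = 0" using supp by blast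
    qed
    then have "(LINT t:{0<..<1}|lebesgue. h t * of_real (deriv \<psi> t))
        = - (LINT t:{0<..<1}|lebesgue. g t * of_real (\<psi> t))"
      using g unfolding is_weak_deriv_def by blast
    moreover have "deriv \<psi> = (\<lambda>t. r u t - r v t)"
      by (intro ext DERIV_imp_deriv D\<psi>)
    ultimately have parts: "(LINT t:{0<..<1}|lebesgue. h t * of_real (r u t - r v t))
        = - (LINT t:{0<..<1}|lebesgue. g t * of_real (\<psi> t))"
      by simp
    define A where "A w = (LINT t:{0<..<1}|lebesgue. h t * of_real (r w t))" for w
    define G where "G = (LINT t:{0<..<1}|lebesgue. g t * of_real (\<psi> t))"
    have "A u - A v = - G"
      unfolding A_def G_def parts[symmetric]
      unfolding of_real_diff right_diff_distrib
      by (intro set_integral_diff(2)[symmetric] integrable_on_unit_interval continuous_intros h cont)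
    then have split: "h y - h x = (A u - h x) - (A v - h y) + G" by (simp add: algebra_simps)
    have Au: "norm (A u - h x) \<le> e / 2"
      unfolding A_def r_def using \<eta> xy by (intro bump_average h d) (auto simp: u_def)
    have Av: "norm (A v - h y) \<le> e / 2"
      unfolding A_def r_def using \<eta> xy by (intro bump_average h d) (auto simp: v_def)
    have Gbound: "norm G \<le> (LINT t:{x<..<y}|lebesgue. norm (g t))"
      unfolding G_def set_lebesgue_integral_def
    proof (rule Bochner_Integration.integral_norm_bound_integral)
      have "\<psi> \<in> borel_measurable borel"
        using D\<psi> by (intro borel_measurable_continuous_onI) (meson DERIV_isCont continuous_at_imp_continuous_on)
      then have "\<psi> \<in> borel_measurable lebesgue" by (simp add: measurable_completion)
      moreover have "(\<lambda>t. indicator {0<..<1} t *\<^sub>R g t) \<in> borel_measurable lebesgue"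
        using intg by (simp add: set_integrable_def borel_measurable_integrable)
      ultimately have "(\<lambda>t. (indicator {0<..<1} t *\<^sub>R g t) * of_real (\<psi> t)) \<in> borel_measurable lebesgue"
        by measurable
      then show "integrable lebesgue (\<lambda>t. indicator {0<..<1} t *\<^sub>R (g t * of_real (\<psi> t)))"
        using intg unfolding set_integrable_def
        by (rule_tac Bochner_Integration.integrable_bound)
           (auto simp: norm_mult indicator_def \<psi>1 mult_left_le)
      show "integrable lebesgue (\<lambda>t. indicator {x<..<y} t *\<^sub>R norm (g t))"
        using intng by (simp add: set_integrable_def)
      show "norm (indicator {0<..<1} t *\<^sub>R (g t * of_real (\<psi> t))) \<le> indicator {x<..<y} t *\<^sub>R norm (g t)" for t
        using supp[of t] \<psi>1[of t] \<eta> by (cases "t \<in> {x<..<y}") (auto simp: indicator_def norm_mult mult_left_le)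
    qed
    have "norm (h y - h x) \<le> norm (A u - h x) + norm (A v - h y) + norm G"
      unfolding split by (rule norm_triangle_le, rule add_right_mono, rule norm_triangle_ineq4)
    then show "norm (h y - h x) \<le> (LINT t:{x<..<y}|lebesgue. norm (g t)) + e"
      using Au Av Gbound by simp
  qed
qed (simp add: set_lebesgue_integral_def)

lemma W11_variation_at_most:
  assumes "h \<in> W11"
  shows "variation_at_most h (W11_norm h)"
proof -
  have h: "continuous_on {0..1} h" and "\<exists>g. is_weak_deriv h g" using assms by (auto simp: W11_def)
  then have g: "is_weak_deriv h (weak_deriv h)" unfolding weak_deriv_def by (metis someI_ex)
  define F where "F x = (LINT t:{0<..<x}|lebesgue. norm (weak_deriv h t))" for x
  have int: "set_integrable lebesgue A (\<lambda>t. norm (weak_deriv h t))"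
    if "A \<in> sets lebesgue" "A \<subseteq> {0<..<1}" for A
    using g that by (intro set_integrable_subset[OF set_integrable_norm]) (auto simp: is_weak_deriv_def)
  have "norm (h y - h x) \<le> F y - F x" if xy: "0 \<le> x" "x \<le> y" "y \<le> 1" for x y
  proof -
    have "F x + (LINT t:{x<..<y}|lebesgue. norm (weak_deriv h t))
        = (LINT t:{0<..<x} \<union> {x<..<y}|lebesgue. norm (weak_deriv h t))"
      unfolding F_def using xy by (intro set_integral_Un[symmetric] int) auto
    also have "\<dots> \<le> F y"
      unfolding F_def set_lebesgue_integral_def using xy
      by (intro integral_mono int[unfolded set_integrable_def]) (auto simp: indicator_def)
    finally show ?thesis using weak_deriv_increment_bound[OF h g xy] by simp
  qed
  moreover have "F 1 - F 0 \<le> W11_norm h"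
  proof -
    have "0 \<le> (LINT x:{0<..<1}|lebesgue. norm (h x))"
      unfolding set_lebesgue_integral_def by (intro Bochner_Integration.integral_nonneg) simp
    then show ?thesis by (simp add: F_def W11_norm_def set_lebesgue_integral_def)
  qed
  ultimately show ?thesis unfolding variation_at_most_def by blast
qed

section \<open>A measure that is the average of its images under the branches\<close>

lemma borel_distr_eq_imp_eq:
  fixes M M' :: "real measure"
  assumes "sets M = sets (restrict_space borel S)" "sets M' = sets M" "S \<in> sets borel"
    and "distr M borel (\<lambda>x. x) = distr M' borel (\<lambda>x. x)"
  shows "M = M'"
proof (rule measure_eqI)
  fix A assume A: "A \<in> sets M"
  have sp: "space M = S" "space M' = S"
    using sets_eq_imp_space_eq[OF assms(1)] sets_eq_imp_space_eq[OF assms(2)]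
    by (auto simp: space_restrict_space)
  have "(\<lambda>x. x) \<in> measurable (restrict_space borel S) borel"
    by (simp add: measurable_restrict_space1)
  then have m: "(\<lambda>x. x) \<in> measurable M borel" "(\<lambda>x. x) \<in> measurable M' borel"
    using assms(1,2) by (simp_all cong: measurable_cong_sets)
  from A have "A \<in> sets borel" "A \<subseteq> S"
    using assms(1,3) by (auto simp: sets_restrict_space_iff)
  then have "emeasure (distr M borel (\<lambda>x. x)) A = emeasure M A"
    "emeasure (distr M' borel (\<lambda>x. x)) A = emeasure M' A"
    using m sp by (simp_all add: emeasure_distr Int_absorb2)
  then show "emeasure M A = emeasure M' A" using assms(4) by simp
qed (use assms in simp)

text \<open>The assumption \<open>char_eq\<close> says that \<open>\<mu>\<close> equals the average of its images under the branches,
  as far as characteristic functions can tell.\<close>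

locale branch_system = prob_space \<mu> for \<mu> :: "real measure" +
  fixes N :: nat and \<psi> :: "nat \<Rightarrow> real \<Rightarrow> real" and a b :: "nat \<Rightarrow> real" and f :: "real \<Rightarrow> real"
  assumes sets_\<mu>: "sets \<mu> = sets (restrict_space borel {0..1})"
    and N_pos: "N > 0"
    and branch: "i \<in> {1..N} \<Longrightarrow> is_branch (a i) (b i) (\<psi> i)"
    and branch_ends: "i \<in> {1..N} \<Longrightarrow> 0 \<le> a i \<and> a i < b i \<and> b i \<le> 1"
    and branches_disjoint: "disjoint_family_on (\<lambda>i. {a i<..<b i}) {1..N}"
    and right_inverse: "i \<in> {1..N} \<Longrightarrow> x \<in> {0<..<1} \<Longrightarrow> f (\<psi> i x) = x"
    and f_measurable: "f \<in> measurable \<mu> \<mu>"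
    and f_invariant: "distr \<mu> \<mu> f = \<mu>"
    and char_eq: "of_nat N * (CLINT x|\<mu>. iexp (t * x)) = (\<Sum>i\<in>{1..N}. CLINT x|\<mu>. iexp (t * \<psi> i x))"
begin

lemma cont_\<psi>: "i \<in> {1..N} \<Longrightarrow> continuous_on UNIV (\<psi> i)"
  using branch by (simp add: is_branch_def)

lemma \<psi>_unit:
  assumes "i \<in> {1..N}" and "x \<in> {0..1}"
  shows "\<psi> i x \<in> {0..1}"
  using is_branch_range[OF branch[OF assms(1)] assms(2)] branch_ends[OF assms(1)] by simp

lemma space_\<mu>: "space \<mu> = {0..1}"
  using sets_eq_imp_space_eq[OF sets_\<mu>] by (simp add: space_restrict_space)

lemma measurable_\<mu>: "measurable \<mu> M = measurable (restrict_space borel {0..1}) M"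
  by (rule measurable_cong_sets) (simp_all add: sets_\<mu>)

lemma id_measurable: "(\<lambda>x. x) \<in> borel_measurable \<mu>"
  by (simp add: measurable_\<mu> measurable_restrict_space1)

lemma \<psi>_measurable: "i \<in> {1..N} \<Longrightarrow> \<psi> i \<in> measurable \<mu> \<mu>"
proof -
  assume i: "i \<in> {1..N}"
  have "\<psi> i \<in> measurable (restrict_space borel {0..1}) (restrict_space borel {0..1})"
    using cont_\<psi>[OF i] \<psi>_unit[OF i]
    by (intro measurable_restrict_space3 borel_measurable_continuous_onI) auto
  then show ?thesis
    using measurable_cong_sets[OF sets_\<mu> sets_\<mu>] by simp
qed

text \<open>The average of the images of \<open>\<mu>\<close> is realised as the distribution of \<open>\<psi> i x\<close> when \<open>i\<close> is chosen
  uniformly and independently of \<open>x\<close>.\<close>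

definition "index_measure = uniform_count_measure {1..N}"

lemma prob_space_index_measure: "prob_space index_measure"
  unfolding index_measure_def using N_pos by (intro prob_space_uniform_count_measure) auto

lemma integral_index_measure:
  fixes g :: "nat \<Rightarrow> complex"
  shows "integral\<^sup>L index_measure g = (\<Sum>i\<in>{1..N}. g i) / of_nat N"
proof -
  have "integral\<^sup>L index_measure g = (\<Sum>i\<in>{1..N}. (1 / real N) *\<^sub>R g i)"
    unfolding index_measure_def uniform_count_measure_def
    by (subst lebesgue_integral_point_measure_finite) auto
  then show ?thesis by (simp add: scaleR_conv_of_real sum_divide_distrib)
qed

lemma branch_measurable: "(\<lambda>z. \<psi> (fst z) (snd z)) \<in> measurable (index_measure \<Otimes>\<^sub>M \<mu>) \<mu>"
proof -
  have index: "sets index_measure = sets (count_space {1..N})"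
    by (simp add: index_measure_def uniform_count_measure_def sets_point_measure)
  show ?thesis
    unfolding measurable_cong_sets[OF sets_pair_measure_cong[OF index refl] refl]
    by (intro measurable_pair_measure_countable1) (simp_all add: \<psi>_measurable)
qed

interpretation I: prob_space index_measure by (rule prob_space_index_measure)
interpretation I\<mu>: pair_prob_space index_measure \<mu> ..

lemma integral_average:
  fixes g :: "real \<Rightarrow> complex"
  assumes "integrable (index_measure \<Otimes>\<^sub>M \<mu>) (\<lambda>z. g (\<psi> (fst z) (snd z)))"
  shows "(\<integral>z. g (\<psi> (fst z) (snd z)) \<partial>(index_measure \<Otimes>\<^sub>M \<mu>)) = (\<Sum>i\<in>{1..N}. \<integral>x. g (\<psi> i x) \<partial>\<mu>) / of_nat N"
  using I\<mu>.integral_fst'[OF assms] by (simp add: integral_index_measure)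

text \<open>By \<open>char_eq\<close> both measures have the same characteristic function; Levy's uniqueness theorem
  applies to them as distributions on the line.\<close>

lemma average_distr: "distr (index_measure \<Otimes>\<^sub>M \<mu>) \<mu> (\<lambda>z. \<psi> (fst z) (snd z)) = \<mu>" (is "?D = \<mu>")
proof -
  have pD: "prob_space ?D" by (intro I\<mu>.P.prob_space_distr branch_measurable)
  have mD: "(\<lambda>x. x) \<in> borel_measurable ?D" using id_measurable by simp
  have "distr \<mu> borel (\<lambda>x. x) = distr ?D borel (\<lambda>x. x)"
  proof (rule Levy_uniqueness)
    show "real_distribution (distr \<mu> borel (\<lambda>x. x))"
      by (intro real_distribution_distr id_measurable)
    show "real_distribution (distr ?D borel (\<lambda>x. x))"
      by (intro prob_space.real_distribution_distr pD mD)
    show "char (distr \<mu> borel (\<lambda>x. x)) = char (distr ?D borel (\<lambda>x. x))"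
    proof
      fix t
      have meas: "(\<lambda>x. iexp (t * x)) \<in> borel_measurable \<mu>"
        using id_measurable by measurable
      have "(\<lambda>z. iexp (t * \<psi> (fst z) (snd z))) \<in> borel_measurable (index_measure \<Otimes>\<^sub>M \<mu>)"
        using measurable_compose[OF branch_measurable meas] by (simp add: case_prod_unfold)
      then have int: "integrable (index_measure \<Otimes>\<^sub>M \<mu>) (\<lambda>z. iexp (t * \<psi> (fst z) (snd z)))"
        by (intro I\<mu>.P.integrable_const_bound[of _ 1]) (auto simp: case_prod_unfold)
      have "char (distr ?D borel (\<lambda>x. x)) t = (CLINT x|?D. iexp (t * x))"
        unfolding char_def by (intro integral_distr mD) simp
      also have "\<dots> = (\<integral>z. iexp (t * \<psi> (fst z) (snd z)) \<partial>(index_measure \<Otimes>\<^sub>M \<mu>))"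
        by (subst integral_distr[OF branch_measurable meas]) (simp add: case_prod_unfold)
      also have "\<dots> = (CLINT x|\<mu>. iexp (t * x))"
        unfolding integral_average[of "\<lambda>y. iexp (t * y)", OF int] char_eq[symmetric] using N_pos by simp
      also have "\<dots> = char (distr \<mu> borel (\<lambda>x. x)) t"
        unfolding char_def by (intro integral_distr[symmetric] id_measurable) simp
      finally show "char (distr \<mu> borel (\<lambda>x. x)) t = char (distr ?D borel (\<lambda>x. x)) t" ..
    qed
  qed
  moreover have "sets ?D = sets \<mu>" by simp
  moreover have "{0..1::real} \<in> sets borel" by simp
  ultimately show ?thesis using borel_distr_eq_imp_eq[OF sets_\<mu>] by metis
qed

lemma integral_branches:
  fixes g :: "real \<Rightarrow> complex"
  assumes "integrable \<mu> g"
  shows "of_nat N * (\<integral>x. g x \<partial>\<mu>) = (\<Sum>i\<in>{1..N}. \<integral>x. g (\<psi> i x) \<partial>\<mu>)"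
proof -
  have m: "g \<in> borel_measurable \<mu>" using assms by simp
  have "integrable (distr (index_measure \<Otimes>\<^sub>M \<mu>) \<mu> (\<lambda>z. \<psi> (fst z) (snd z))) g"
    unfolding average_distr by (rule assms)
  then have int: "integrable (index_measure \<Otimes>\<^sub>M \<mu>) (\<lambda>z. g (\<psi> (fst z) (snd z)))"
    by (subst (asm) integrable_distr_eq[OF branch_measurable m]) (simp add: case_prod_unfold)
  have "(\<integral>x. g x \<partial>\<mu>) = (\<integral>x. g x \<partial>distr (index_measure \<Otimes>\<^sub>M \<mu>) \<mu> (\<lambda>z. \<psi> (fst z) (snd z)))"
    unfolding average_distr ..
  also have "\<dots> = (\<integral>z. g (\<psi> (fst z) (snd z)) \<partial>(index_measure \<Otimes>\<^sub>M \<mu>))"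
    by (subst integral_distr[OF branch_measurable m]) (simp add: case_prod_unfold)
  finally show ?thesis using integral_average[OF int] N_pos by simp
qed

lemma measure_branches:
  assumes A: "A \<in> sets \<mu>"
  shows "real N * prob A = (\<Sum>i\<in>{1..N}. prob (\<psi> i -` A \<inter> space \<mu>))"
proof -
  have *: "(\<integral>x. complex_of_real (indicator B x) \<partial>\<mu>) = prob B" if "B \<in> sets \<mu>" for B
    using that by (simp add: integral_complex_of_real)
  have "complex_of_real (real N * prob A) = of_nat N * (\<integral>x. of_real (indicator A x) \<partial>\<mu>)"
    using *[OF A] by simp
  also have "\<dots> = (\<Sum>i\<in>{1..N}. \<integral>x. of_real (indicator A (\<psi> i x)) \<partial>\<mu>)"
    using A by (intro integral_branches integrable_of_real) (simp add: emeasure_eq_measure)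
  also have "\<dots> = (\<Sum>i\<in>{1..N}. \<integral>x. of_real (indicator (\<psi> i -` A \<inter> space \<mu>) x) \<partial>\<mu>)"
    by (intro sum.cong refl Bochner_Integration.integral_cong) (auto simp: indicator_def)
  also have "\<dots> = (\<Sum>i\<in>{1..N}. complex_of_real (prob (\<psi> i -` A \<inter> space \<mu>)))"
    by (intro sum.cong refl * measurable_sets[OF \<psi>_measurable A])
  also have "\<dots> = complex_of_real (\<Sum>i\<in>{1..N}. prob (\<psi> i -` A \<inter> space \<mu>))" by simp
  finally show ?thesis unfolding of_real_eq_iff .
qed

lemma singleton_in_sets: "x \<in> {0..1} \<Longrightarrow> {x} \<in> sets \<mu>"
  by (simp add: sets_\<mu> sets_restrict_space_iff)

text \<open>By disjointness at most one branch takes the value \<open>p\<close> on \<open>[0,1]\<close>, and only at one point. That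
  point is again \<open>0\<close> or \<open>1\<close>, because interior points go to interior points.\<close>

lemma endpoint_mass:
  assumes p: "p \<in> {0, 1}"
  shows "real N * prob {p} \<le> max (prob {0}) (prob {1})"
proof -
  define S where "S = {i \<in> {1..N}. \<exists>x\<in>{0..1}. \<psi> i x = p}"
  have unique: "i = j" if "i \<in> S" "j \<in> S" for i j
  proof (rule ccontr)
    assume "i \<noteq> j"
    have range: "p \<in> {a k..b k}" if "k \<in> S" for k
      using that is_branch_range[OF branch, of k] unfolding S_def by blast
    have ij: "i \<in> {1..N}" "j \<in> {1..N}" "p \<in> {a i..b i}" "p \<in> {a j..b j}"
      using that range by (auto simp: S_def)
    have "a i = a j \<and> p = 0 \<or> b i = b j \<and> p = 1"
      using p ij branch_ends[OF ij(1)] branch_ends[OF ij(2)] by auto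
    \<comment> \<open>Two intervals with a common left end, or a common right end, overlap.\<close>
    then have "(max (a i) (a j) + min (b i) (b j)) / 2 \<in> {a i<..<b i} \<inter> {a j<..<b j}"
      using branch_ends[OF ij(1)] branch_ends[OF ij(2)] by (auto simp: max_def min_def field_simps)
    then show False
      using branches_disjoint \<open>i \<noteq> j\<close> ij unfolding disjoint_family_on_def by blast
  qed
  have le: "prob (\<psi> i -` {p} \<inter> space \<mu>) \<le> max (prob {0}) (prob {1})" if "i \<in> S" for i
  proof -
    from that have i: "i \<in> {1..N}" and "\<exists>x\<in>{0..1}. \<psi> i x = p" by (auto simp: S_def)
    then obtain x where x: "x \<in> {0..1}" "\<psi> i x = p" by blast
    have "x \<notin> {0<..<1}"
      using is_branch_interior[OF branch[OF i], of x] branch_ends[OF i] x p by auto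
    then have "x = 0 \<or> x = 1" using x by auto
    moreover have "\<psi> i -` {p} \<inter> space \<mu> = {x}"
    proof -
      have "\<psi> i y = p \<longleftrightarrow> y = x" for y
        using inj_eq[OF is_branch_inj[OF branch[OF i]], of y x] x(2) by simp
      then show ?thesis using x(1) by (auto simp: space_\<mu>)
    qed
    ultimately show ?thesis by auto
  qed
  have "real N * prob {p} = (\<Sum>i\<in>{1..N}. prob (\<psi> i -` {p} \<inter> space \<mu>))"
    using p by (intro measure_branches singleton_in_sets) auto
  also have "\<dots> = (\<Sum>i\<in>S. prob (\<psi> i -` {p} \<inter> space \<mu>))"
  proof (rule sum.mono_neutral_right)
    show "\<forall>i\<in>{1..N} - S. prob (\<psi> i -` {p} \<inter> space \<mu>) = 0"
    proof
      fix i assume "i \<in> {1..N} - S"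
      then have "\<psi> i -` {p} \<inter> space \<mu> = {}" by (auto simp: S_def space_\<mu>)
      then show "prob (\<psi> i -` {p} \<inter> space \<mu>) = 0" by simp
    qed
  qed (auto simp: S_def)
  also have "\<dots> \<le> max (prob {0}) (prob {1})"
  proof (cases "S = {}")
    case True
    then show ?thesis by (simp add: le_max_iff_disj)
  next
    case False
    then obtain i where "i \<in> S" by blast
    then have "S = {i}" using unique by blast
    then show ?thesis using le[of i] by simp
  qed
  finally show ?thesis .
qed

text \<open>The larger of the two endpoint masses is at least \<open>N\<close> times itself.\<close>

lemma AE_interior:
  assumes "N \<ge> 2"
  shows "AE x in \<mu>. x \<in> {0<..<1}"
proof -
  define m where "m = max (prob {0}) (prob {1})"
  have "0 \<le> m" by (simp add: m_def le_max_iff_disj)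
  have "real N * m \<le> m"
  proof (cases "prob {0} \<le> prob {1}")
    case True
    then show ?thesis using endpoint_mass[of 1] by (simp add: m_def)
  next
    case False
    then show ?thesis using endpoint_mass[of 0] by (simp add: m_def)
  qed
  moreover have "2 * m \<le> real N * m" using assms \<open>0 \<le> m\<close> by (intro mult_right_mono) auto
  ultimately have "m = 0" using \<open>0 \<le> m\<close> by linarith
  then have "prob {0} \<le> 0" "prob {1} \<le> 0"
    unfolding m_def by (metis max.cobounded1, metis max.cobounded2)
  then have "prob {0} = 0" "prob {1} = 0"
    by (simp_all add: measure_le_0_iff)
  then have "{0} \<in> null_sets \<mu>" "{1} \<in> null_sets \<mu>"
    by (simp_all add: null_sets_def emeasure_eq_measure singleton_in_sets)
  then have "AE x in \<mu>. x \<notin> {0}" "AE x in \<mu>. x \<notin> {1}"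
    by (blast intro: AE_not_in)+
  then show ?thesis
    using AE_space by eventually_elim (auto simp: space_\<mu>)
qed

section \<open>Decay of correlations\<close>

lemma invariance:
  fixes g :: "real \<Rightarrow> complex"
  assumes "integrable \<mu> g"
  shows "integrable \<mu> (\<lambda>x. g (f x))" and "(\<integral>x. g (f x) \<partial>\<mu>) = (\<integral>x. g x \<partial>\<mu>)"
proof -
  have m: "g \<in> borel_measurable \<mu>" using assms by simp
  show "integrable \<mu> (\<lambda>x. g (f x))"
    using assms by (subst integrable_distr_eq[OF f_measurable m, symmetric]) (simp add: f_invariant)
  show "(\<integral>x. g (f x) \<partial>\<mu>) = (\<integral>x. g x \<partial>\<mu>)"
    by (subst integral_distr[OF f_measurable m, symmetric]) (simp add: f_invariant)
qed

lemma invariance_norm: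
  fixes g :: "real \<Rightarrow> complex"
  assumes "integrable \<mu> g"
  shows "(\<integral>x. norm (g (f x)) \<partial>\<mu>) = (\<integral>x. norm (g x) \<partial>\<mu>)"
proof -
  have "(\<lambda>x. norm (g x)) \<in> borel_measurable \<mu>" using assms by simp
  then show ?thesis
    by (subst integral_distr[OF f_measurable, symmetric]) (simp_all add: f_invariant)
qed

lemma variation_integrable_mult:
  fixes g :: "real \<Rightarrow> complex"
  assumes V: "variation_at_most h V" and h: "h \<in> borel_measurable \<mu>" and g: "integrable \<mu> g"
  shows "integrable \<mu> (\<lambda>x. h x * g x)"
proof (rule Bochner_Integration.integrable_bound)
  show "integrable \<mu> (\<lambda>x. of_real (norm (h 0) + V) * g x)" using g by simp
  show "(\<lambda>x. h x * g x) \<in> borel_measurable \<mu>" using h g by measurable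
  have "norm (h x * g x) \<le> norm (of_real (norm (h 0) + V) * g x)" if "x \<in> {0..1}" for x
  proof -
    have "norm (h x) \<le> norm (h 0) + norm (h x - h 0)"
      using norm_triangle_ineq[of "h 0" "h x - h 0"] by simp
    also have "\<dots> \<le> norm (h 0) + V"
      using variation_at_most_norm_diff[OF V, of 0 x] that by simp
    also have "\<dots> \<le> \<bar>norm (h 0) + V\<bar>" by simp
    finally have "norm (h x) \<le> norm (complex_of_real (norm (h 0) + V))"
      by (simp only: norm_of_real)
    then show ?thesis unfolding norm_mult by (rule mult_right_mono) simp
  qed
  then show "AE x in \<mu>. norm (h x * g x) \<le> norm (of_real (norm (h 0) + V) * g x)"
    by (intro AE_I2) (simp add: space_\<mu>)
qed

text \<open>The mean of \<open>h\<close> is an average of values of \<open>h\<close>, hence differs from each of them by at most the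
  variation.\<close>

lemma covariance_le_variation:
  fixes g :: "real \<Rightarrow> complex"
  assumes V: "variation_at_most h V" and h: "h \<in> borel_measurable \<mu>" and g: "integrable \<mu> g"
  shows "norm ((\<integral>x. h x * g x \<partial>\<mu>) - (\<integral>x. h x \<partial>\<mu>) * (\<integral>x. g x \<partial>\<mu>)) \<le> V * (\<integral>x. norm (g x) \<partial>\<mu>)"
proof -
  define c where "c = (\<integral>x. h x \<partial>\<mu>)"
  have inth: "integrable \<mu> h" using variation_integrable_mult[OF V h, of "\<lambda>_. 1"] by simp
  have close: "norm (h x - c) \<le> V" if "x \<in> {0..1}" for x
  proof -
    have "h x - c = (\<integral>y. h x - h y \<partial>\<mu>)"
      unfolding c_def using inth by (simp add: prob_space)
    also have "norm \<dots> \<le> (\<integral>y. V \<partial>\<mu>)"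
      using inth variation_at_most_norm_diff[OF V _ that]
      by (intro Bochner_Integration.integral_norm_bound_integral) (auto simp: space_\<mu>)
    finally show ?thesis by (simp add: prob_space)
  qed
  have inthg: "integrable \<mu> (\<lambda>x. h x * g x)" using variation_integrable_mult[OF V h g] .
  have "(\<integral>x. h x * g x \<partial>\<mu>) - c * (\<integral>x. g x \<partial>\<mu>) = (\<integral>x. h x * g x - c * g x \<partial>\<mu>)"
    using inthg g by simp
  also have "norm \<dots> \<le> (\<integral>x. V * norm (g x) \<partial>\<mu>)"
  proof (rule Bochner_Integration.integral_norm_bound_integral)
    show "norm (h x * g x - c * g x) \<le> V * norm (g x)" if "x \<in> space \<mu>" for x
      using close[of x] that unfolding left_diff_distrib[symmetric] norm_mult
      by (intro mult_right_mono) (auto simp: space_\<mu>)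
  qed (use inthg g in auto)
  finally show ?thesis unfolding c_def by simp
qed

text \<open>The averaging formula for \<open>h (g \<circ> f)\<close>. Since \<open>f (\<psi> i x) = x\<close> may fail at \<open>0\<close> and \<open>1\<close>, it is
  essential that these points carry no mass.\<close>

lemma transfer_duality:
  fixes g :: "real \<Rightarrow> complex"
  assumes "N \<ge> 2" and V: "variation_at_most h V" and h: "h \<in> borel_measurable \<mu>" and g: "integrable \<mu> g"
  shows "of_nat N * (\<integral>x. h x * g (f x) \<partial>\<mu>) = (\<integral>x. (\<Sum>i\<in>{1..N}. h (\<psi> i x)) * g x \<partial>\<mu>)"
proof -
  have int: "integrable \<mu> (\<lambda>x. h x * g (f x))"
    using variation_integrable_mult[OF V h invariance(1)[OF g]] .
  have branch_int: "integrable \<mu> (\<lambda>x. h (\<psi> i x) * g x)" if i: "i \<in> {1..N}" for i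
  proof (rule variation_integrable_mult)
    show "variation_at_most (\<lambda>x. h (\<psi> i x)) V"
      using variation_at_most_sum_branches[OF V, of "{i}" a b \<psi>] branch[OF i] branch_ends[OF i]
      by (simp add: disjoint_family_on_def)
    show "(\<lambda>x. h (\<psi> i x)) \<in> borel_measurable \<mu>"
      using measurable_compose[OF \<psi>_measurable[OF i] h] .
  qed fact
  have "of_nat N * (\<integral>x. h x * g (f x) \<partial>\<mu>) = (\<Sum>i\<in>{1..N}. \<integral>x. h (\<psi> i x) * g (f (\<psi> i x)) \<partial>\<mu>)"
    using integral_branches[OF int] .
  also have "\<dots> = (\<Sum>i\<in>{1..N}. \<integral>x. h (\<psi> i x) * g x \<partial>\<mu>)"
  proof (intro sum.cong refl integral_cong_AE)
    fix i assume i: "i \<in> {1..N}"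
    show "(\<lambda>x. h (\<psi> i x) * g x) \<in> borel_measurable \<mu>" using branch_int[OF i] by simp
    show "(\<lambda>x. h (\<psi> i x) * g (f (\<psi> i x))) \<in> borel_measurable \<mu>"
      using measurable_compose[OF \<psi>_measurable[OF i] borel_measurable_integrable[OF int]] .
    show "AE x in \<mu>. h (\<psi> i x) * g (f (\<psi> i x)) = h (\<psi> i x) * g x"
      using AE_interior[OF \<open>N \<ge> 2\<close>] by eventually_elim (simp add: right_inverse[OF i])
  qed
  also have "\<dots> = (\<integral>x. (\<Sum>i\<in>{1..N}. h (\<psi> i x)) * g x \<partial>\<mu>)"
    unfolding sum_distrib_right using branch_int by (rule Bochner_Integration.integral_sum[symmetric])
  finally show ?thesis .
qed

lemma integrable_iterate:
  fixes \<phi> :: "real \<Rightarrow> complex"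
  assumes "integrable \<mu> \<phi>"
  shows "integrable \<mu> (\<lambda>x. \<phi> ((f ^^ n) x))"
proof (induction n)
  case (Suc n)
  then show ?case using invariance(1)[OF Suc] by (simp add: funpow_swap1)
qed (use assms in simp)

lemma norm_integral_iterate:
  fixes \<phi> :: "real \<Rightarrow> complex"
  assumes "integrable \<mu> \<phi>"
  shows "(\<integral>x. norm (\<phi> ((f ^^ n) x)) \<partial>\<mu>) = (\<integral>x. norm (\<phi> x) \<partial>\<mu>)"
proof (induction n)
  case (Suc n)
  then show ?case using invariance_norm[OF integrable_iterate[OF assms, of n]] by (simp add: funpow_swap1)
qed simp

text \<open>For \<open>N \<ge> 2\<close>, duality gives that \<open>N\<close> times the covariance of \<open>h\<close> and \<open>\<phi> \<circ> f\<^sup>n\<^sup>+\<^sup>1\<close> is the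
  covariance of \<open>L h\<close> and \<open>\<phi> \<circ> f\<^sup>n\<close>. The induction works for all \<open>h\<close> at once because passing to \<open>L h\<close>
  does not increase the variation.\<close>

lemma covariance_decay:
  fixes \<phi> :: "real \<Rightarrow> complex"
  assumes V: "variation_at_most h V" and h: "h \<in> borel_measurable \<mu>" and \<phi>: "integrable \<mu> \<phi>"
  shows "norm ((\<integral>x. h x * \<phi> ((f ^^ n) x) \<partial>\<mu>) - (\<integral>x. h x \<partial>\<mu>) * (\<integral>x. \<phi> ((f ^^ n) x) \<partial>\<mu>))
     \<le> (1 / real N) ^ n * (V * (\<integral>x. norm (\<phi> x) \<partial>\<mu>))"
proof (cases "N = 1")
  case True
  then show ?thesis
    using covariance_le_variation[OF V h integrable_iterate[OF \<phi>, of n]] norm_integral_iterate[OF \<phi>, of n]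
    by simp
next
  case False
  then have "N \<ge> 2" using N_pos by simp
  show ?thesis
    using V h
  proof (induction n arbitrary: h)
    case 0
    then show ?case using covariance_le_variation[OF _ _ \<phi>, of h V] by simp
  next
    case (Suc n)
    define Lh where "Lh x = (\<Sum>i\<in>{1..N}. h (\<psi> i x))" for x
    define \<Phi> where "\<Phi> x = \<phi> ((f ^^ n) x)" for x
    have int\<Phi>: "integrable \<mu> \<Phi>" unfolding \<Phi>_def by (rule integrable_iterate[OF \<phi>])
    have "variation_at_most Lh V"
      unfolding Lh_def[abs_def] using Suc.prems(1) branch branch_ends branches_disjoint
      by (intro variation_at_most_sum_branches) auto
    moreover have "Lh \<in> borel_measurable \<mu>"
      unfolding Lh_def[abs_def] using measurable_compose[OF \<psi>_measurable Suc.prems(2)] by measurable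
    ultimately have IH: "norm ((\<integral>x. Lh x * \<Phi> x \<partial>\<mu>) - (\<integral>x. Lh x \<partial>\<mu>) * (\<integral>x. \<Phi> x \<partial>\<mu>))
        \<le> (1 / real N) ^ n * (V * (\<integral>x. norm (\<phi> x) \<partial>\<mu>))"
      unfolding \<Phi>_def by (rule Suc.IH)
    have "of_nat N * (\<integral>x. h x * \<Phi> (f x) \<partial>\<mu>) = (\<integral>x. Lh x * \<Phi> x \<partial>\<mu>)"
      unfolding Lh_def by (rule transfer_duality[OF \<open>N \<ge> 2\<close> Suc.prems int\<Phi>])
    moreover have "of_nat N * (\<integral>x. h x \<partial>\<mu>) = (\<integral>x. Lh x \<partial>\<mu>)"
      using transfer_duality[OF \<open>N \<ge> 2\<close> Suc.prems, of "\<lambda>_. 1"] by (simp add: Lh_def)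
    moreover have "(\<integral>x. \<Phi> (f x) \<partial>\<mu>) = (\<integral>x. \<Phi> x \<partial>\<mu>)" by (rule invariance(2)[OF int\<Phi>])
    ultimately have "(\<integral>x. Lh x * \<Phi> x \<partial>\<mu>) - (\<integral>x. Lh x \<partial>\<mu>) * (\<integral>x. \<Phi> x \<partial>\<mu>)
       = of_nat N * ((\<integral>x. h x * \<Phi> (f x) \<partial>\<mu>) - (\<integral>x. h x \<partial>\<mu>) * (\<integral>x. \<Phi> (f x) \<partial>\<mu>))"
      by (simp add: right_diff_distrib mult.assoc)
    with IH have "real N * norm ((\<integral>x. h x * \<Phi> (f x) \<partial>\<mu>) - (\<integral>x. h x \<partial>\<mu>) * (\<integral>x. \<Phi> (f x) \<partial>\<mu>))
        \<le> (1 / real N) ^ n * (V * (\<integral>x. norm (\<phi> x) \<partial>\<mu>))"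
      by (simp add: norm_mult)
    then have "norm ((\<integral>x. h x * \<Phi> (f x) \<partial>\<mu>) - (\<integral>x. h x \<partial>\<mu>) * (\<integral>x. \<Phi> (f x) \<partial>\<mu>))
        \<le> (1 / real N) ^ Suc n * (V * (\<integral>x. norm (\<phi> x) \<partial>\<mu>))"
      using N_pos by (simp add: field_simps)
    then show ?case by (simp add: \<Phi>_def funpow_swap1)
  qed
qed

end

section \<open>The measure of maximal entropy\<close>

lemma continuous_integrable_unit_interval:
  fixes g :: "real \<Rightarrow> complex"
  assumes "prob_space \<mu>" and sets: "sets \<mu> = sets (restrict_space borel {0..1::real})"
    and g: "continuous_on {0..1} g"
  shows "integrable \<mu> g"
proof -
  interpret prob_space \<mu> by fact
  have space: "space \<mu> = {0..1}"
    using sets_eq_imp_space_eq[OF sets] by (simp add: space_restrict_space)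
  have "g \<in> borel_measurable (restrict_space borel {0..1})"
    by (rule borel_measurable_continuous_on_restrict[OF g])
  then have m: "g \<in> borel_measurable \<mu>"
    using measurable_cong_sets[OF sets refl] by blast
  have "bounded (g ` {0..1})"
    using compact_continuous_image[OF g] by (intro compact_imp_bounded) auto
  then obtain B where "\<And>x. x \<in> {0..1} \<Longrightarrow> norm (g x) \<le> B"
    unfolding bounded_iff by blast
  then show ?thesis
    using m by (intro integrable_const_bound[of _ B] AE_I2) (auto simp: space)
qed

text \<open>The spectral decomposition determines \<open>Q h\<close> on the open interval. Both sides of it extend
  continuously, so it holds at the endpoints with the extended branches. Integrating it removes
  \<open>Q h\<close>.\<close>

lemma spectral_decomposition_average:
  assumes spec: "spectral_decomposition N I f \<mu> Q"
    and \<mu>: "prob_space \<mu>" "sets \<mu> = sets (restrict_space borel {0..1})"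
    and cont: "\<And>i. i \<in> {1..N} \<Longrightarrow> continuous_on UNIV (\<psi> i)"
    and unit: "\<And>i x. i \<in> {1..N} \<Longrightarrow> x \<in> {0..1} \<Longrightarrow> \<psi> i x \<in> {0..1}"
    and inv: "\<And>i x. i \<in> {1..N} \<Longrightarrow> x \<in> {0<..<1} \<Longrightarrow> the_inv_into (I i) f x = \<psi> i x"
    and h: "h \<in> W11"
  shows "of_nat N * (\<integral>x. h x \<partial>\<mu>) = (\<Sum>i\<in>{1..N}. \<integral>x. h (\<psi> i x) \<partial>\<mu>)"
proof -
  interpret prob_space \<mu> by fact
  have space: "space \<mu> = {0..1}"
    using sets_eq_imp_space_eq[OF \<mu>(2)] by (simp add: space_restrict_space)
  have "Q h \<in> W11" using spec h by (auto simp: spectral_decomposition_def W11_bounded_operator_def)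
  then have contQ: "continuous_on {0..1} (Q h)" and conth: "continuous_on {0..1} h"
    using h by (auto simp: W11_def)
  have conth\<psi>: "continuous_on {0..1} (\<lambda>x. h (\<psi> i x))" if "i \<in> {1..N}" for i
    using unit[OF that] continuous_on_subset[OF cont[OF that]]
    by (intro continuous_on_compose2[OF conth]) auto
  define c where "c = of_nat N * (\<integral>x. h x \<partial>\<mu>)"
  have eq: "(\<Sum>i\<in>{1..N}. h (\<psi> i x)) = c + Q h x" if "x \<in> {0..1}" for x
  proof -
    define k where "k x = (\<Sum>i\<in>{1..N}. h (\<psi> i x)) - (c + Q h x)" for x
    have "continuous_on {0..1} k"
      unfolding k_def by (intro continuous_intros conth\<psi> contQ)
    then have "continuous_on (closure {0<..<1}) k" by simp
    moreover have "k x = 0" if "x \<in> {0<..<1}" for x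
      using that spec h inv by (simp add: k_def spectral_decomposition_def transfer0_def c_def)
    moreover have "x \<in> closure {0<..<1}" using that by simp
    ultimately have "k x = 0" by (rule continuous_constant_on_closure)
    then show ?thesis by (simp add: k_def)
  qed
  have "(\<Sum>i\<in>{1..N}. \<integral>x. h (\<psi> i x) \<partial>\<mu>) = (\<integral>x. (\<Sum>i\<in>{1..N}. h (\<psi> i x)) \<partial>\<mu>)"
    by (intro Bochner_Integration.integral_sum[symmetric] continuous_integrable_unit_interval[OF \<mu>] conth\<psi>)
  also have "\<dots> = (\<integral>x. c + Q h x \<partial>\<mu>)"
    by (intro Bochner_Integration.integral_cong refl eq) (simp add: space)
  also have "\<dots> = c + (\<integral>x. Q h x \<partial>\<mu>)"
    using continuous_integrable_unit_interval[OF \<mu> contQ] by (simp add: prob_space)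
  also have "(\<integral>x. Q h x \<partial>\<mu>) = 0" using spec h by (simp add: spectral_decomposition_def)
  finally show ?thesis by (simp add: c_def)
qed

theorem corollary4p8:
  fixes N :: nat and I :: "nat \<Rightarrow> real set" and f :: "real \<Rightarrow> real"
    and \<mu>BM :: "real measure" and \<nu> :: real
  assumes "full_branch_map N I f"
    and "transfer0_preserves_W11 N I f"
    and "is_mu_BM N I f \<mu>BM"
    and "\<nu> > 1 / real N"
  shows "\<exists>C>0. \<forall>h\<in>W11. \<forall>\<phi> :: real \<Rightarrow> complex. integrable \<mu>BM \<phi> \<longrightarrow> (\<forall>n::nat.
           norm ((\<integral>x. h x * \<phi> ((f ^^ n) x) \<partial>\<mu>BM)
                 - (\<integral>x. h x \<partial>\<mu>BM) * (\<integral>x. \<phi> ((f ^^ n) x) \<partial>\<mu>BM))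
           \<le> C * \<nu> ^ n * W11_norm h * (\<integral>x. norm (\<phi> x) \<partial>\<mu>BM))"
proof -
  have part: "interval_partition N I"
    and mono: "\<And>i. i \<in> {1..N} \<Longrightarrow> strict_mono_on (I i) f \<or> strict_antimono_on (I i) f"
    and full: "\<And>i. i \<in> {1..N} \<Longrightarrow> f ` I i = {0<..<1}"
    using assms(1) by (auto simp: full_branch_map_def pw_monotone_map_def)
  obtain a b where I: "\<And>i. i \<in> {1..N} \<Longrightarrow> a i < b i \<and> I i = {a i<..<b i}"
    using part unfolding interval_partition_def by metis
  have disj: "disjoint_family_on (\<lambda>i. {a i<..<b i}) {1..N}"
    using part I by (simp add: interval_partition_def disjoint_family_on_def)
  have cover: "(\<Union>i\<in>{1..N}. closure (I i)) = {0..1}" using part by (simp add: interval_partition_def)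
  have ends: "0 \<le> a i \<and> a i < b i \<and> b i \<le> 1" if i: "i \<in> {1..N}" for i
  proof -
    have "closure (I i) \<subseteq> {0..1}" using cover i by blast
    then show ?thesis using I[OF i] by simp
  qed
  have "N > 0" using cover by (cases N) auto
  have "\<exists>\<psi>. is_branch (a i) (b i) \<psi> \<and>
      (\<forall>x\<in>{0<..<1}. f (\<psi> x) = x \<and> the_inv_into (I i) f x = \<psi> x)" if i: "i \<in> {1..N}" for i
  proof -
    have "a i < b i" and Ii: "I i = {a i<..<b i}" using I[OF i] by auto
    then show ?thesis
      using inverse_branch_exists[OF _ mono[OF i, unfolded Ii] full[OF i, unfolded Ii]]
      unfolding Ii by blast
  qed
  then obtain \<psi> where branch: "\<And>i. i \<in> {1..N} \<Longrightarrow> is_branch (a i) (b i) (\<psi> i)"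
    and inverse: "\<And>i. i \<in> {1..N} \<Longrightarrow> \<forall>x\<in>{0<..<1}. f (\<psi> i x) = x \<and> the_inv_into (I i) f x = \<psi> i x"
    by metis
  obtain Q where spec: "spectral_decomposition N I f \<mu>BM Q" and inv: "invariant_prob f \<mu>BM"
    using assms(3) by (auto simp: is_mu_BM_def max_entropy_measure_def)
  then have prob: "prob_space \<mu>BM" "sets \<mu>BM = sets (restrict_space borel {0..1})"
    by (simp_all add: invariant_prob_def)
  interpret prob_space \<mu>BM by fact
  interpret branch_system \<mu>BM N \<psi> a b f
  proof
    show "of_nat N * (CLINT x|\<mu>BM. iexp (t * x)) = (\<Sum>i\<in>{1..N}. CLINT x|\<mu>BM. iexp (t * \<psi> i x))" for t
    proof (rule spectral_decomposition_average[OF spec prob _ _ _ iexp_in_W11])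
      fix i assume i: "i \<in> {1..N}"
      show "continuous_on UNIV (\<psi> i)" using branch[OF i] by (simp add: is_branch_def)
      show "\<psi> i x \<in> {0..1}" if "x \<in> {0..1}" for x
        using is_branch_range[OF branch[OF i] that] ends[OF i] by simp
      show "the_inv_into (I i) f x = \<psi> i x" if "x \<in> {0<..<1}" for x
        using inverse[OF i] that by blast
    qed
    show "f \<in> measurable \<mu>BM \<mu>BM" and "distr \<mu>BM \<mu>BM f = \<mu>BM"
      using inv by (simp_all add: invariant_prob_def)
    show "f (\<psi> i x) = x" if "i \<in> {1..N}" "x \<in> {0<..<1}" for i x
      using inverse[OF that(1)] that(2) by blast
  qed (fact prob(2) \<open>N > 0\<close> branch ends disj)+
  show ?thesis
  proof (intro exI[of _ 1] conjI ballI allI impI)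
    fix h :: "real \<Rightarrow> complex" and \<phi> :: "real \<Rightarrow> complex" and n :: nat
    assume h: "h \<in> W11" and \<phi>: "integrable \<mu>BM \<phi>"
    have V: "variation_at_most h (W11_norm h)" by (rule W11_variation_at_most[OF h])
    have "0 \<le> W11_norm h" using variation_at_most_norm_diff[OF V, of 0 0] by simp
    have "h \<in> borel_measurable \<mu>BM"
      using continuous_integrable_unit_interval[OF prob] h by (auto simp: W11_def)
    from covariance_decay[OF V this \<phi>]
    have "norm ((\<integral>x. h x * \<phi> ((f ^^ n) x) \<partial>\<mu>BM) - (\<integral>x. h x \<partial>\<mu>BM) * (\<integral>x. \<phi> ((f ^^ n) x) \<partial>\<mu>BM))
        \<le> (1 / real N) ^ n * (W11_norm h * (\<integral>x. norm (\<phi> x) \<partial>\<mu>BM))" .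
    also have "\<dots> \<le> \<nu> ^ n * (W11_norm h * (\<integral>x. norm (\<phi> x) \<partial>\<mu>BM))"
      using assms(4) \<open>0 \<le> W11_norm h\<close> by (intro mult_right_mono power_mono) auto
    finally show "norm ((\<integral>x. h x * \<phi> ((f ^^ n) x) \<partial>\<mu>BM) - (\<integral>x. h x \<partial>\<mu>BM) * (\<integral>x. \<phi> ((f ^^ n) x) \<partial>\<mu>BM))
        \<le> 1 * \<nu> ^ n * W11_norm h * (\<integral>x. norm (\<phi> x) \<partial>\<mu>BM)"
      by (simp add: mult.assoc)
  qed simp
qed

end
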